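(* Let the matrix $\mathbf A$ of a linear operator $A:\mathbb R^n\to\mathbb R^n$ be positive (all entries $>0$). Let its second compound matrix $\mathbf A^{(2)}$ be strictly $\mathcal J$-sign-symmetric. Then the operator $A$ has the first positive simple eigenvalue $\lambda_1=\rho(A)$, and the second positive simple eigenvalue $\lambda_2$: $$\lambda_1>\lambda_2>|\lambda_3|>\ldots>0.$$
   Context: A real $m\times m$ matrix $\mathbf B=(b_{ij})$ is strictly $\mathcal J$-sign-symmetric if it has no zero entries and there is a subset $\mathcal J\subseteq\{1,\dots,m\}$ such that $b_{ij}<0$ if and only if one of $i,j$ belongs to $\mathcal J$ and the other to $\{1,\dots,m\}\setminus\mathcal J$. The second compound matrix $\mathbf A^{(2)}$ of an $n\times n$ matrix $\mathbf A=(a_{ij})$ is the $\binom n2\times\binom n2$ matrix of minors $A\begin{pmatrix} i&j\\k&l\end{pmatrix}=a_{ik}a_{jl}-a_{il}a_{jk}$, with rows indexed by pairs $(i,j)$, $i<j$, and columns by pairs $(k,l)$, $k<l$, the pairs being numbered $1,\dots,\binom n2$ in lexicographic order. $\rho(A)$ is the spectral radius, and $\lambda_1,\lambda_2,\lambda_3,\ldots$ are the eigenvalues of $A$ enumerated in order of decrease of their moduli, taking multiplicities into account.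
   Formalization: The tail "|λ₃| > … > 0" is read as |λ₃| ≥ … ≥ 0, since strictness fails: a_ij = 1+ij (n = 3) meets the hypotheses but has λ₃ = 0. What is proved is λ₁ > λ₂ > 0 and λ₂ > |λ_i| for all i ≥ 3; n ≥ 2 is assumed so that λ₂ exists. *)

theory Defs
  imports "Jordan_Normal_Form.Spectral_Radius"
begin

text \<open>
  Rows and columns are numbered from 0 here, so the index set \<open>{1,\<dots>,m}\<close> becomes \<open>{0..<m}\<close>.
\<close>

definition strictly_J_sign_symmetric :: "real mat \<Rightarrow> bool" where
  "strictly_J_sign_symmetric B \<longleftrightarrow>
     square_mat B \<and>
     (\<forall>i < dim_row B. \<forall>j < dim_row B. B $$ (i, j) \<noteq> 0) \<and>
     (\<exists>J \<subseteq> {0..<dim_row B}. \<forall>i < dim_row B. \<forall>j < dim_row B.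
        B $$ (i, j) < 0 \<longleftrightarrow>
          (i \<in> J \<and> j \<in> {0..<dim_row B} - J) \<or> (j \<in> J \<and> i \<in> {0..<dim_row B} - J))"

text \<open>The pairs \<open>(i, j)\<close> with \<open>i < j < n\<close>, in lexicographic order.\<close>

definition index_pairs :: "nat \<Rightarrow> (nat \<times> nat) list" where
  "index_pairs n = concat (map (\<lambda>i. map (\<lambda>j. (i, j)) [Suc i..<n]) [0..<n])"

definition minor2 :: "real mat \<Rightarrow> nat \<times> nat \<Rightarrow> nat \<times> nat \<Rightarrow> real" where
  "minor2 A = (\<lambda>(i, j) (k, l). A $$ (i, k) * A $$ (j, l) - A $$ (i, l) * A $$ (j, k))"

definition second_compound :: "real mat \<Rightarrow> real mat" where
  "second_compound A = 
     mat (dim_row A choose 2) (dim_row A choose 2)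
       (\<lambda>(a, b). minor2 A (index_pairs (dim_row A) ! a) (index_pairs (dim_row A) ! b))"

abbreviation cmat :: "real mat \<Rightarrow> complex mat" where
  "cmat A \<equiv> map_mat complex_of_real A"

text \<open>
  All complex eigenvalues with algebraic multiplicity, in order of non-increasing modulus.
  The order among eigenvalues of equal modulus is arbitrary, so this is a relation.
\<close>

definition eigenvalue_enumeration :: "real mat \<Rightarrow> complex list \<Rightarrow> bool" where
  "eigenvalue_enumeration A ev \<longleftrightarrow>
     char_poly (cmat A) = (\<Prod>x\<leftarrow>ev. [:- x, 1:]) \<and> sorted_wrt (\<lambda>x y. cmod x \<ge> cmod y) ev"

definition simple_eigenvalue :: "real mat \<Rightarrow> complex \<Rightarrow> bool" where
  "simple_eigenvalue A x \<longleftrightarrow> eigenvalue (cmat A) x \<and> order x (char_poly (cmat A)) = 1"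

lemma set_index_pairs: "set (index_pairs n) = {(i, j). i < j \<and> j < n}"
  by (force simp: index_pairs_def)

lemma sorted_index_pairs:
  "sorted_wrt (\<lambda>(i, j) (k, l). i < k \<or> (i = k \<and> j < l)) (index_pairs n)"
proof -
  have "sorted_wrt (\<lambda>(i, j) (k, l). i < k \<or> (i = k \<and> j < l))
          (concat (map (\<lambda>i. map (\<lambda>j. (i, j)) [Suc i..<n]) [0..<m]))" for m
    by (induction m) (auto simp: sorted_wrt_append sorted_wrt_map)
  then show ?thesis
    by (simp add: index_pairs_def)
qed

lemma length_index_pairs: "length (index_pairs n) = n choose 2"
proof -
  have eq: "length (index_pairs n) = (\<Sum>i<n. n - Suc i)"
    by (simp add: index_pairs_def length_concat o_def interv_sum_list_conv_sum_set_nat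
        atLeast0LessThan del: upt_Suc)
  have "(\<Sum>i<n. n - Suc i) = (\<Sum>i<n. i)"
    by (rule sum.nat_diff_reindex)
  also have "\<dots> = n choose 2"
    by (induction n) (simp_all add: numeral_2_eq_2)
  finally show ?thesis
    using eq by simp
qed

lemma eigenvalue_enumeration_length:
  assumes "A \<in> carrier_mat n n" "eigenvalue_enumeration A ev"
  shows "length ev = n"
proof -
  have "degree (\<Prod>x\<leftarrow>ev. [:- x, 1:]) = length ev"
    by (rule degree_linear_factors)
  moreover have "degree (char_poly (cmat A)) = n"
    using assms(1) degree_monic_char_poly[of "cmat A" n] by simp
  ultimately show ?thesis
    using assms(2) by (simp add: eigenvalue_enumeration_def)
qed

lemma eigenvalue_enumeration_exists:
  assumes "A \<in> carrier_mat n n"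
  shows "\<exists>ev. eigenvalue_enumeration A ev"
proof -
  obtain as where as: "char_poly (cmat A) = (\<Prod>x\<leftarrow>as. [:- x, 1:])"
    using char_poly_factorized[of "cmat A" n] assms by auto
  let ?ev = "sort_key (\<lambda>x. - cmod x) as"
  have "(\<Prod>x\<leftarrow>?ev. [:- x, 1:]) = (\<Prod>x\<leftarrow>as. [:- x, 1:])"
    by (simp flip: prod_mset_prod_list)
  moreover have "sorted_wrt (\<lambda>x y. cmod x \<ge> cmod y) ?ev"
    using sorted_sort_key[of "\<lambda>x. - cmod x" as] by (simp add: sorted_map)
  ultimately have "eigenvalue_enumeration A ?ev"
    using as by (simp add: eigenvalue_enumeration_def)
  then show ?thesis
    by blast
qed

end

theory Submission
  imports Defs
begin

text \<open>
  A positive matrix \<open>B\<close> has a positive eigenvector \<open>x\<close> for \<open>r = \<rho>(B)\<close>. Scaling by \<open>x\<close> makes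
  \<open>B / r\<close> row-stochastic with positive entries, and such a matrix strictly contracts the diameter
  of the entries of a vector; this excludes at once further eigenvalues of modulus at least \<open>r\<close>
  and a higher algebraic multiplicity of \<open>r\<close>. Schur triangularisation shows that the eigenvalues of
  the second compound are the products \<open>\<lambda>\<^sub>i \<lambda>\<^sub>j\<close> with \<open>i < j\<close>. A strictly J-sign-symmetric matrix
  is similar, by a diagonal matrix of signs, to a positive one, so exactly one of these products
  has maximal modulus and it is positive. It must be \<open>\<lambda>\<^sub>1 \<lambda>\<^sub>2\<close>, whence \<open>\<lambda>\<^sub>2\<close> is positive
  and \<open>\<bar>\<lambda>\<^sub>i\<bar> < \<lambda>\<^sub>2\<close> for \<open>i > 2\<close>.
\<close>

subsection \<open>Positive matrices\<close>

text \<open>The lower Collatz-Wielandt bound. If \<open>s\<close> exceeded the spectral radius,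
  \<open>B\<close> could be scaled so that its powers stay bounded, while their action on
  \<open>y\<close> would still grow geometrically.\<close>

lemma spectral_radius_ge_of_supersolution:
  fixes B :: "real mat" and y :: "nat \<Rightarrow> real"
  assumes B: "B \<in> carrier_mat N N" and N: "N > 0"
    and nonneg: "\<And>i j. i < N \<Longrightarrow> j < N \<Longrightarrow> B $$ (i, j) \<ge> 0"
    and y: "\<And>i. i < N \<Longrightarrow> y i > 0"
    and super: "\<And>i. i < N \<Longrightarrow> s * y i \<le> (\<Sum>j = 0..<N. B $$ (i, j) * y j)"
  shows "s \<le> spectral_radius (cmat B)"
proof (rule ccontr)
  define R where "R = spectral_radius (cmat B)"
  assume "\<not> s \<le> spectral_radius (cmat B)"
  then have Rs: "R < s" by (simp add: R_def)
  have cB: "cmat B \<in> carrier_mat N N" using B by simp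
  have R0: "R \<ge> 0"
    using spectral_radius_mem_max(1)[OF cB N] by (auto simp: R_def)
  \<comment> \<open>Any \<open>t\<close> strictly between \<open>R\<close> and \<open>s\<close>
    serves: \<open>B / t\<close> then has spectral radius below 1, while the growth factor
    \<open>s / t\<close> is above 1.\<close>
  define t where "t = (R + s) / 2"
  have t: "t > 0" "R < t" "t < s" using R0 Rs by (auto simp: t_def)
  define C where "C = (1 / t) \<cdot>\<^sub>m B"
  have C: "C \<in> carrier_mat N N" using B by (simp add: C_def)
  have cC: "cmat C \<in> carrier_mat N N" using C by simp
  have Cij: "C $$ (i, j) = B $$ (i, j) / t" if "i < N" "j < N" for i j
    using that B by (simp add: C_def)
  have "spectral_radius (cmat C) < 1"
  proof -
    obtain m where m: "eigenvalue (cmat C) m" "cmod m = spectral_radius (cmat C)"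
      using spectral_radius_mem_max(1)[OF cC N] by (auto simp: spectrum_def)
    then obtain v where v: "v \<in> carrier_vec N" "v \<noteq> 0\<^sub>v N" "cmat C *\<^sub>v v = m \<cdot>\<^sub>v v"
      using C by (auto simp: eigenvalue_def eigenvector_def)
    \<comment> \<open>An eigenvector of \<open>C\<close> for \<open>m\<close> is one of
      \<open>B\<close> for \<open>t * m\<close>, so \<open>t * cmod m\<close> is at most
      \<open>R\<close>, hence below \<open>t\<close>.\<close>
    have "cmat B = of_real t \<cdot>\<^sub>m cmat C"
      using B t by (intro eq_matI) (auto simp: C_def)
    then have "cmat B *\<^sub>v v = of_real t \<cdot>\<^sub>v (cmat C *\<^sub>v v)"
      using cC v(1) by (intro eq_vecI) (auto simp: scalar_prod_def sum_distrib_left mult.assoc)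
    also have "\<dots> = (of_real t * m) \<cdot>\<^sub>v v" 
      using v by (auto simp: smult_smult_assoc)
    finally have "eigenvalue (cmat B) (of_real t * m)"
      unfolding eigenvalue_def eigenvector_def using v B by (intro exI[of _ v]) auto
    then have "cmod (of_real t * m) \<le> R"
      unfolding R_def by (intro spectral_radius_mem_max(2)[OF cB N] imageI) (simp add: spectrum_def)
    then have "t * cmod m \<le> R" using t by (simp add: norm_mult)
    then have "t * cmod m < t * 1" using t by linarith
    then have "cmod m < 1" using t(1) by (simp only: mult_less_cancel_left_pos)
    then show ?thesis using m by simp
  qed
  then obtain c where c: "\<And>k. norm_bound (cmat C ^\<^sub>m k) c"
    using spectral_radius_jnf_norm_bound_less_1_upper_triangular[OF cC] by blast
  have powC: "cmat C ^\<^sub>m k = cmat (C ^\<^sub>m k)" for k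
    using of_real_hom.mat_hom_pow[OF C, of k] by (rule sym)
  have bound: "(C ^\<^sub>m k) $$ (i, j) \<le> c" if "i < N" "j < N" for i j k
  proof -
    have "norm ((cmat C ^\<^sub>m k) $$ (i, j)) \<le> c"
      using c[of k] that C unfolding norm_bound_def by simp
    moreover have "(cmat C ^\<^sub>m k) $$ (i, j) = of_real ((C ^\<^sub>m k) $$ (i, j))"
      unfolding powC using that C by simp
    ultimately show ?thesis by simp
  qed
  have step: "(C ^\<^sub>m Suc k) $$ (i, j) = (\<Sum>l = 0..<N. (C ^\<^sub>m k) $$ (i, l) * C $$ (l, j))"
    if "i < N" "j < N" for i j k
    using that C by (simp add: scalar_prod_def)
  have pos: "(C ^\<^sub>m k) $$ (i, j) \<ge> 0" if "i < N" "j < N" for i j k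
    using that
  proof (induction k arbitrary: i j)
    case 0
    then show ?case using C by simp
  next
    case (Suc k)
    show ?case unfolding step[OF Suc.prems]
      using Suc nonneg t by (intro sum_nonneg mult_nonneg_nonneg) (auto simp: Cij)
  qed
  \<comment> \<open>Induction on \<open>k\<close>: the inequality for \<open>B\<close> and
    \<open>y\<close> is divided by \<open>t\<close> and multiplied by the nonnegative matrix
    \<open>C ^\<^sub>m k\<close>.\<close>
  have growth: "(s / t) ^ k * y i \<le> (\<Sum>j = 0..<N. (C ^\<^sub>m k) $$ (i, j) * y j)" if "i < N" for i k
    using that
  proof (induction k)
    case 0
    have "(\<Sum>j = 0..<N. (C ^\<^sub>m 0) $$ (i, j) * y j) = (\<Sum>j = 0..<N. if i = j then y j else 0)"
      using C 0 by (intro sum.cong) auto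
    then show ?case using 0 by simp
  next
    case (Suc k)
    have "(s / t) ^ Suc k * y i = s / t * ((s / t) ^ k * y i)" by simp
    also have "\<dots> \<le> s / t * (\<Sum>l = 0..<N. (C ^\<^sub>m k) $$ (i, l) * y l)"
      using Suc t by (intro mult_left_mono) auto
    also have "\<dots> = (\<Sum>l = 0..<N. (C ^\<^sub>m k) $$ (i, l) * (s * y l / t))"
      by (simp add: sum_distrib_left mult_ac)
    also have "\<dots> \<le> (\<Sum>l = 0..<N. (C ^\<^sub>m k) $$ (i, l) * ((\<Sum>j = 0..<N. B $$ (l, j) * y j) / t))"
      using super pos Suc.prems t by (intro sum_mono mult_left_mono divide_right_mono) auto
    also have "\<dots> = (\<Sum>l = 0..<N. \<Sum>j = 0..<N. (C ^\<^sub>m k) $$ (i, l) * C $$ (l, j) * y j)"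
      by (intro sum.cong refl) (auto simp: Cij sum_distrib_left sum_divide_distrib mult.assoc)
    also have "\<dots> = (\<Sum>j = 0..<N. \<Sum>l = 0..<N. (C ^\<^sub>m k) $$ (i, l) * C $$ (l, j) * y j)"
      by (rule sum.swap)
    also have "\<dots> = (\<Sum>j = 0..<N. (C ^\<^sub>m Suc k) $$ (i, j) * y j)"
      using Suc.prems by (intro sum.cong refl) (auto simp: step sum_distrib_right simp del: pow_mat.simps)
    finally show ?case .
  qed
  have "1 < s / t" using t by simp
  \<comment> \<open>Row 0 of \<open>C ^\<^sub>m k\<close> applied to \<open>y\<close> is at most
    \<open>c * sum y {0..<N}\<close>; \<open>k\<close> is taken so large that the growth bound
    exceeds this.\<close>
  then obtain k where "c * sum y {0..<N} / y 0 < (s / t) ^ k"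
    using real_arch_pow by blast
  then have "c * sum y {0..<N} < (s / t) ^ k * y 0"
    using y[OF N] by (simp add: field_simps)
  also have "\<dots> \<le> (\<Sum>j = 0..<N. (C ^\<^sub>m k) $$ (0, j) * y j)"
    by (rule growth[OF N])
  also have "\<dots> \<le> (\<Sum>j = 0..<N. c * y j)"
    using bound N y by (intro sum_mono mult_right_mono) (auto intro: less_imp_le)
  also have "\<dots> = c * sum y {0..<N}" by (simp add: sum_distrib_left)
  finally show False by simp
qed

text \<open>By the triangle inequality the moduli \<open>x\<close> of an eigenvector for an
  eigenvalue of maximal modulus \<open>R\<close> satisfy \<open>R * x i <= y i\<close>, where
  \<open>y\<close> is \<open>B\<close> applied to \<open>x\<close>. Were this strict anywhere, one
  more application of \<open>B\<close> would make it strict everywhere, and \<open>y\<close> would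
  witness a spectral radius above \<open>R\<close>.\<close>

lemma perron_vector:
  fixes B :: "real mat"
  assumes B: "B \<in> carrier_mat N N" and N: "N > 0"
    and pos: "\<And>i j. i < N \<Longrightarrow> j < N \<Longrightarrow> B $$ (i, j) > 0"
  obtains r x where "r > 0" "\<And>i. i < N \<Longrightarrow> x i > 0"
    "\<And>i. i < N \<Longrightarrow> (\<Sum>j = 0..<N. B $$ (i, j) * x j) = r * x i"
proof -
  define R where "R = spectral_radius (cmat B)"
  have cB: "cmat B \<in> carrier_mat N N" using B by simp
  obtain m where m: "eigenvalue (cmat B) m" "cmod m = R"
    using spectral_radius_mem_max(1)[OF cB N] by (auto simp: spectrum_def R_def)
  then obtain v where v: "v \<in> carrier_vec N" "v \<noteq> 0\<^sub>v N" "cmat B *\<^sub>v v = m \<cdot>\<^sub>v v"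
    using B by (auto simp: eigenvalue_def eigenvector_def)
  have R0: "R \<ge> 0" using m by auto
  define x where "x i = cmod (v $ i)" for i
  define y where "y i = (\<Sum>j = 0..<N. B $$ (i, j) * x j)" for i
  have le: "R * x i \<le> y i" if "i < N" for i
  proof -
    have "m * v $ i = (\<Sum>j = 0..<N. of_real (B $$ (i, j)) * v $ j)"
      using arg_cong[OF v(3), of "\<lambda>u. u $ i"] that v(1) B by (simp add: scalar_prod_def)
    then have "R * x i = cmod (\<Sum>j = 0..<N. of_real (B $$ (i, j)) * v $ j)"
      using m by (metis norm_mult x_def)
    also have "\<dots> \<le> (\<Sum>j = 0..<N. cmod (of_real (B $$ (i, j)) * v $ j))"
      by (rule norm_sum)
    also have "\<dots> = y i"
      unfolding y_def using pos that by (intro sum.cong) (auto simp: norm_mult x_def less_imp_le)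
    finally show ?thesis .
  qed
  have "\<exists>j<N. v $ j \<noteq> 0"
    using v(1,2) by (metis carrier_vecD eq_vecI index_zero_vec)
  then obtain j0 where j0: "j0 < N" "x j0 > 0" by (auto simp: x_def)
  \<comment> \<open>One positive coordinate of \<open>x\<close> suffices, because every entry of
    \<open>B\<close> is positive; \<open>x\<close> itself may still have zeros at this
    point.\<close>
  have y: "y i > 0" if "i < N" for i
    unfolding y_def using that j0 pos
    by (intro sum_pos2[of _ j0]) (auto simp: x_def less_imp_le)
  show ?thesis
  proof (cases "\<forall>i<N. R * x i = y i")
    case True
    have Rx: "0 < R" "0 < x i" if "i < N" for i
      using y[OF that] True that R0 by (auto simp: zero_less_mult_iff x_def less_le)
    show ?thesis
      by (rule that[of R x]) (use Rx True N in \<open>auto simp: y_def\<close>)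
  next
    case False
    then obtain i0 where i0: "i0 < N" "R * x i0 < y i0"
      using le by force
    define z where "z i = (\<Sum>j = 0..<N. B $$ (i, j) * y j)" for i
    have z: "R * y i < z i" if "i < N" for i
    proof -
      have "0 < (\<Sum>j = 0..<N. B $$ (i, j) * (y j - R * x j))"
        using that i0 pos le
        by (intro sum_pos2[of _ i0]) (auto simp: less_imp_le)
      also have "\<dots> = z i - R * y i"
        by (simp add: z_def y_def right_diff_distrib sum_subtractf sum_distrib_left mult_ac)
      finally show ?thesis by simp
    qed
    \<comment> \<open>The largest \<open>s\<close> with \<open>s * y i <= z i\<close> for all
      \<open>i\<close>. As a minimum of finitely many quotients above \<open>R\<close> it is itself
      above \<open>R\<close>.\<close>
    define s where "s = Min ((\<lambda>i. z i / y i) ` {0..<N})"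
    have "R < s"
      unfolding s_def using N z y by (subst Min_gr_iff) (auto simp: field_simps)
    moreover have "s \<le> R" unfolding R_def
    proof (rule spectral_radius_ge_of_supersolution[OF B N])
      show "s * y i \<le> (\<Sum>j = 0..<N. B $$ (i, j) * y j)" if "i < N" for i
      proof -
        have "s \<le> z i / y i" unfolding s_def using that by (intro Min_le) auto
        then show ?thesis using y[OF that] by (simp add: field_simps z_def)
      qed
    qed (use pos y in \<open>auto intro: less_imp_le\<close>)
    ultimately show ?thesis by simp
  qed
qed

section \<open>Dominance and simplicity of the Perron root\<close>

text \<open>With \<open>c = 0\<close> this concerns eigenvectors, with other \<open>c\<close> the
  next vector of a Jordan chain over \<open>x\<close>. In the coordinates \<open>v i / x i\<close>
  the constant \<open>c\<close> cancels from differences, which are multiplied by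
  \<open>m / r\<close>, of modulus at least 1; averaging with positive weights shrinks the largest
  difference strictly unless it is 0.\<close>

lemma generalized_eigenvector_parallel:
  fixes B :: "real mat" and x :: "nat \<Rightarrow> real" and v :: "nat \<Rightarrow> complex"
  assumes N: "N > 0"
    and pos: "\<And>i j. i < N \<Longrightarrow> j < N \<Longrightarrow> B $$ (i, j) > 0"
    and r: "r > 0" and x: "\<And>i. i < N \<Longrightarrow> x i > 0"
    and Bx: "\<And>i. i < N \<Longrightarrow> (\<Sum>j = 0..<N. B $$ (i, j) * x j) = r * x i"
    and Bv: "\<And>i. i < N \<Longrightarrow>
      (\<Sum>j = 0..<N. of_real (B $$ (i, j)) * v j) = m * v i + c * of_real (x i)"
    and m: "r \<le> cmod m"
  shows "\<exists>d. \<forall>i<N. v i = d * of_real (x i)"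
proof -
  define w where "w i = v i / of_real (x i)" for i
  \<comment> \<open>\<open>B / r\<close> conjugated by the diagonal matrix of \<open>x\<close>; the
    eigenvector equation for \<open>x\<close> says that its rows sum to 1.\<close>
  define S where "S i j = B $$ (i, j) * x j / (r * x i)" for i j
  have v: "v i = w i * of_real (x i)" if "i < N" for i
    using x[OF that] by (simp add: w_def)
  have Spos: "S i j > 0" if "i < N" "j < N" for i j
    using that pos x r by (simp add: S_def)
  have S1: "(\<Sum>j = 0..<N. S i j) = 1" if "i < N" for i
    using Bx[OF that] x[OF that] r by (simp add: S_def flip: sum_divide_distrib)
  have Sw: "(\<Sum>j = 0..<N. of_real (S i j) * w j) = (m * w i + c) / of_real r" if "i < N" for i
  proof -
    have "(\<Sum>j = 0..<N. of_real (S i j) * w j)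
        = (\<Sum>j = 0..<N. of_real (B $$ (i, j)) * v j) / of_real (r * x i)"
      unfolding sum_divide_distrib by (intro sum.cong refl) (auto simp: S_def v)
    also have "\<dots> = (m * w i + c) / of_real r"
      unfolding Bv[OF that] v[OF that] using x[OF that] r by (simp add: field_simps)
    finally show ?thesis .
  qed
  let ?P = "{0..<N} \<times> {0..<N}"
  define d where "d = Max ((\<lambda>(i, k). cmod (w i - w k)) ` ?P)"
  have "d \<in> (\<lambda>(i, k). cmod (w i - w k)) ` ?P"
    unfolding d_def using N by (intro Max_in) auto
  then obtain i k where ik: "i < N" "k < N" "d = cmod (w i - w k)" by auto
  have d: "cmod (w j - w l) \<le> d" if "j < N" "l < N" for j l
    unfolding d_def using that by (intro Max_ge) (auto intro!: image_eqI[of _ _ "(j, l)"])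
  have "d = 0"
  proof (rule ccontr)
    assume "d \<noteq> 0"
    then have d0: "d > 0" using ik by simp
    have S1c: "(\<Sum>j = 0..<N. complex_of_real (S i j)) = 1" if "i < N" for i
      using S1[OF that] by (metis of_real_1 of_real_sum)
    \<comment> \<open>Inserting row sums equal to 1 turns the difference of two averages into a
      double average of the differences \<open>w j - w l\<close>.\<close>
    have "(m / of_real r) * (w i - w k)
        = (\<Sum>j = 0..<N. of_real (S i j) * w j) - (\<Sum>l = 0..<N. of_real (S k l) * w l)"
      unfolding Sw[OF ik(1)] Sw[OF ik(2)] using r by (simp add: field_simps)
    also have "\<dots> = (\<Sum>j = 0..<N. of_real (S i j) * w j) * (\<Sum>l = 0..<N. of_real (S k l))
        - (\<Sum>j = 0..<N. of_real (S i j)) * (\<Sum>l = 0..<N. of_real (S k l) * w l)"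
      using ik by (simp add: S1c)
    also have "\<dots> = (\<Sum>j = 0..<N. \<Sum>l = 0..<N. of_real (S i j * S k l) * (w j - w l))"
      unfolding sum_product by (simp add: right_diff_distrib sum_subtractf mult_ac)
    finally have eq: "(m / of_real r) * (w i - w k) = \<dots>" .
    have "d \<le> cmod (m / of_real r) * d"
      using m r d0 by (simp add: norm_divide field_simps)
    also have "\<dots> = cmod (\<Sum>j = 0..<N. \<Sum>l = 0..<N. of_real (S i j * S k l) * (w j - w l))"
      unfolding ik(3) norm_mult[symmetric] eq ..
    also have "\<dots> \<le> (\<Sum>j = 0..<N. \<Sum>l = 0..<N. S i j * S k l * cmod (w j - w l))"
      using ik Spos
      by (intro order_trans[OF norm_sum] sum_mono)
        (auto simp: norm_mult abs_of_pos intro!: sum_mono order_trans[OF norm_sum])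
    \<comment> \<open>Strictness comes from the terms with \<open>l = j\<close>: their difference is
      0, below \<open>d\<close>, and their weight is positive.\<close>
    also have "\<dots> < (\<Sum>j = 0..<N. \<Sum>l = 0..<N. S i j * S k l * d)"
    proof (rule sum_strict_mono)
      fix j assume j: "j \<in> {0..<N}"
      have le: "S i j * S k l * cmod (w j - w l) \<le> S i j * S k l * d" if "l < N" for l
        using that j ik Spos d by (intro mult_left_mono) (auto intro!: mult_nonneg_nonneg less_imp_le)
      show "(\<Sum>l = 0..<N. S i j * S k l * cmod (w j - w l)) < (\<Sum>l = 0..<N. S i j * S k l * d)"
        by (rule sum_strict_mono_ex1) (use le j ik Spos d0 in \<open>auto intro!: bexI[of _ j]\<close>)
    qed (use N in auto)
    also have "\<dots> = (\<Sum>j = 0..<N. S i j) * (\<Sum>l = 0..<N. S k l) * d"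
      unfolding sum_product by (simp only: sum_distrib_right)
    also have "\<dots> = d" using ik by (simp add: S1)
    finally show False by simp
  qed
  then have "w i = w 0" if "i < N" for i
    using d[OF that N] by simp
  then have "v i = w 0 * of_real (x i)" if "i < N" for i
    using v[OF that] that by metis
  then show ?thesis by blast
qed

text \<open>Comparing positions in \<open>as\<close> rather than values yields dominance and
  algebraic simplicity together. A second position of modulus at least \<open>r\<close> would make
  two columns of an invertible Schur basis proportional to \<open>x\<close>.\<close>

lemma perron_dominant:
  fixes B :: "real mat"
  assumes B: "B \<in> carrier_mat N N" and N: "N > 0"
    and pos: "\<And>i j. i < N \<Longrightarrow> j < N \<Longrightarrow> B $$ (i, j) > 0"
    and as: "char_poly (cmat B) = (\<Prod>a\<leftarrow>as. [:- a, 1:])"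
  obtains k r where "k < length as" "r > 0" "as ! k = complex_of_real r"
    "\<And>i. i < length as \<Longrightarrow> i \<noteq> k \<Longrightarrow> cmod (as ! i) < r"
proof -
  obtain r x where r: "r > 0" and x: "\<And>i. i < N \<Longrightarrow> x i > 0"
    and Bx: "\<And>i. i < N \<Longrightarrow> (\<Sum>j = 0..<N. B $$ (i, j) * x j) = r * x i"
    using perron_vector[OF B N pos] by blast
  have cB: "cmat B \<in> carrier_mat N N" using B by simp
  have "eigenvector (cmat B) (vec N (\<lambda>i. of_real (x i))) (of_real r)"
    unfolding eigenvector_def
  proof (intro conjI)
    show "vec N (\<lambda>i. complex_of_real (x i)) \<noteq> 0\<^sub>v (dim_row (cmat B))"
      using x[OF N] N B by (auto dest!: arg_cong[of _ _ "\<lambda>u. u $ 0"])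
    show "cmat B *\<^sub>v vec N (\<lambda>i. of_real (x i)) = of_real r \<cdot>\<^sub>v vec N (\<lambda>i. of_real (x i))"
      using B by (intro eq_vecI) 
        (auto simp: scalar_prod_def simp flip: of_real_mult of_real_sum Bx)
  qed (use B in auto)
  then have "poly (char_poly (cmat B)) (of_real r) = 0"
    using eigenvalue_root_char_poly[OF cB] by (auto simp: eigenvalue_def)
  then have "complex_of_real r \<in> set as"
    unfolding as by (auto simp: poly_prod_list prod_list_zero_iff)
  then obtain k where k: "k < length as" "as ! k = of_real r"
    by (auto simp: in_set_conv_nth)
  have "cmod (as ! i) < r" if i: "i < length as" "i \<noteq> k" for i
  proof (rule ccontr)
    assume "\<not> cmod (as ! i) < r"
    then have m: "r \<le> cmod (as ! i)" by simp
    define m where "m = as ! i"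
    \<comment> \<open>The two values may coincide, so the inclusion must respect multiplicity;
      removing position \<open>k\<close> from the list still leaves position
      \<open>i\<close>.\<close>
    have "{#as ! k, as ! i#} \<subseteq># mset as"
    proof -
      have "as ! j \<in># mset (take l as @ drop (Suc l) as)"
        if "j < length as" "l < length as" "j \<noteq> l" for j l
      proof (cases "j < l")
        case True
        then have "take l as ! j \<in> set (take l as)" using that by (intro nth_mem) auto
        then show ?thesis using True by simp
      next
        case False
        then have "drop (Suc l) as ! (j - Suc l) \<in> set (drop (Suc l) as)"
          using that by (intro nth_mem) auto
        then show ?thesis using False that by simp
      qed
      from this[of i k] have "as ! i \<in># mset (take k as @ drop (Suc k) as)"
        using i k by auto
      moreover have "mset as = add_mset (as ! k) (mset (take k as @ drop (Suc k) as))"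
        using k(1) by (subst id_take_nth_drop[of k as]) auto
      ultimately show ?thesis by (simp add: mset_subset_eq_single)
    qed
    then obtain M where "mset as = {#as ! k, as ! i#} + M"
      by (metis subset_mset.le_iff_add)
    moreover obtain rest where "mset rest = M" using ex_mset by blast
    ultimately have mset: "mset (of_real r # m # rest) = mset as"
      using k by (simp add: m_def)
    let ?es = "of_real r # m # rest"
    have "(\<Prod>a\<leftarrow>as. [:- a, 1:]) = (\<Prod>a\<leftarrow>?es. [:- a, 1:])"
      unfolding prod_mset_prod_list[symmetric] mset_map mset ..
    then have es: "char_poly (cmat B) = (\<Prod>a\<leftarrow>?es. [:- a, 1:])" using as by simp
    \<comment> \<open>The Schur form keeps the prescribed order on the diagonal, so placing
      \<open>r\<close> and \<open>m\<close> in front puts them in the first two columns.\<close>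
    obtain T P Q where sd: "schur_decomposition (cmat B) ?es = (T, P, Q)"
      by (cases "schur_decomposition (cmat B) ?es")
    from schur_decomposition[OF cB es sd]
    have wit: "similar_mat_wit (cmat B) T P Q" and ut: "upper_triangular T"
      and diag: "diag_mat T = ?es" by auto
    note W = similar_mat_witD2[OF cB wit]
    have T: "dim_row T = N" "dim_col T = N" using W by auto
    have "length (diag_mat T) = N" using T by (simp add: diag_mat_def)
    then have N2: "N \<ge> 2" using diag by simp
    have T00: "T $$ (0, 0) = of_real r" and T11: "T $$ (1, 1) = m"
      using arg_cong[OF diag, of "\<lambda>l. l ! 0"] arg_cong[OF diag, of "\<lambda>l. l ! 1"] N2 T
      by (auto simp: diag_mat_def)
    have T0: "T $$ (l, j) = 0" if "j < l" "l < N" for l j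
      using ut that T by auto
    have BP: "cmat B * P = P * T"
    proof -
      have "cmat B * P = P * T * (Q * P)"
        using W by (subst W(3)) (simp add: assoc_mult_mat[of _ N N _ N _ N])
      then show ?thesis using W by simp
    qed
    have BPij: "(\<Sum>j = 0..<N. of_real (B $$ (i, j)) * P $$ (j, l)) = (\<Sum>j = 0..<N. P $$ (i, j) * T $$ (j, l))"
      if "i < N" "l < N" for i l
      using arg_cong[OF BP, of "\<lambda>M. M $$ (i, l)"] W(5,6) B that by (simp add: scalar_prod_def)
    have col0: "(\<Sum>j = 0..<N. of_real (B $$ (i, j)) * P $$ (j, 0)) = of_real r * P $$ (i, 0)"
      if "i < N" for i
    proof -
      have "(\<Sum>j = 0..<N. P $$ (i, j) * T $$ (j, 0)) = (\<Sum>j \<in> {0}. P $$ (i, j) * T $$ (j, 0))"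
        using N by (intro sum.mono_neutral_right) (auto simp: T0)
      then show ?thesis using BPij[of i 0] that N by (simp add: T00)
    qed
    \<comment> \<open>Column 1 of \<open>P\<close> is an eigenvector up to a multiple of column 0,
      which covers \<open>m = r\<close> with a Jordan block as well.\<close>
    have col1: "(\<Sum>j = 0..<N. of_real (B $$ (i, j)) * P $$ (j, 1))
        = m * P $$ (i, 1) + T $$ (0, 1) * P $$ (i, 0)" if "i < N" for i
    proof -
      have "(\<Sum>j = 0..<N. P $$ (i, j) * T $$ (j, 1)) = (\<Sum>j \<in> {0, 1}. P $$ (i, j) * T $$ (j, 1))"
        using N2 by (intro sum.mono_neutral_right) (auto simp: T0)
      then show ?thesis using BPij[of i 1] that N2 T11 by simp
    qed
    obtain d0 where d0: "\<And>i. i < N \<Longrightarrow> P $$ (i, 0) = d0 * of_real (x i)"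
      using generalized_eigenvector_parallel[OF N pos r x Bx,
          of "\<lambda>i. P $$ (i, 0)" "of_real r" 0] col0 r by auto
    \<comment> \<open>Column 0 is already \<open>d0\<close> times \<open>x\<close>, so the coupling
      term has the form \<open>c * x\<close> with \<open>c = T $$ (0, 1) * d0\<close>.\<close>
    obtain d1 where d1: "\<And>i. i < N \<Longrightarrow> P $$ (i, 1) = d1 * of_real (x i)"
      using generalized_eigenvector_parallel[OF N pos r x Bx,
          of "\<lambda>i. P $$ (i, 1)" m "T $$ (0, 1) * d0"] col1 m by (auto simp: d0 m_def)
    have QP: "(\<Sum>j = 0..<N. Q $$ (i, j) * P $$ (j, l)) = (if i = l then 1 else 0)"
      if "i < N" "l < N" for i l
      using arg_cong[OF W(2), of "\<lambda>M. M $$ (i, l)"] W(6,7) that by (simp add: scalar_prod_def)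
    \<comment> \<open>\<open>q\<close> is \<open>Q\<close> applied to \<open>x\<close>. Since
      \<open>Q * P\<close> is the identity, \<open>d0 * q 0 = 1\<close> makes \<open>q 0\<close>
      nonzero, \<open>d1 * q 0 = 0\<close> then gives \<open>d1 = 0\<close>, against
      \<open>d1 * q 1 = 1\<close>.\<close>
    define q where "q i = (\<Sum>j = 0..<N. Q $$ (i, j) * of_real (x j))" for i
    have "d0 * q 0 = 1" "d1 * q 0 = 0" "d1 * q 1 = 1"
      using QP[of 0 0] QP[of 0 1] QP[of 1 1] N2
      by (auto simp: d0 d1[unfolded One_nat_def] q_def sum_distrib_left mult_ac)
    then show False by auto
  qed
  with that[OF k(1) r k(2)] show ?thesis by blast
qed

subsection \<open>The second compound\<close>

text \<open>Generalises \<open>minor2\<close> from the reals to commutative rings, since Schur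
  triangularisation takes place over the complex numbers.\<close>

definition minor_2 :: "'a::comm_ring_1 mat \<Rightarrow> nat \<times> nat \<Rightarrow> nat \<times> nat \<Rightarrow> 'a" where
  "minor_2 A = (\<lambda>(i, j) (k, l). A $$ (i, k) * A $$ (j, l) - A $$ (i, l) * A $$ (j, k))"

definition compound_2 :: "'a::comm_ring_1 mat \<Rightarrow> 'a mat" where
  "compound_2 A = mat (dim_row A choose 2) (dim_row A choose 2)
     (\<lambda>(a, b). minor_2 A (index_pairs (dim_row A) ! a) (index_pairs (dim_row A) ! b))"

lemma second_compound_eq: "second_compound A = compound_2 A"
  by (simp add: second_compound_def compound_2_def minor2_def minor_2_def)

lemma compound_2_carrier: "A \<in> carrier_mat n n \<Longrightarrow> compound_2 A \<in> carrier_mat (n choose 2) (n choose 2)"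
  by (simp add: compound_2_def)

lemma index_compound_2:
  "A \<in> carrier_mat n n \<Longrightarrow> a < n choose 2 \<Longrightarrow> b < n choose 2 \<Longrightarrow>
    compound_2 A $$ (a, b) = minor_2 A (index_pairs n ! a) (index_pairs n ! b)"
  by (auto simp: compound_2_def)

lemma distinct_index_pairs: "distinct (index_pairs n)"
proof -
  have "index_pairs n ! a \<noteq> index_pairs n ! b" if "a < b" "b < length (index_pairs n)" for a b
    using sorted_wrt_nth_less[OF sorted_index_pairs that] by (auto split: prod.splits)
  then show ?thesis
    by (metis distinct_conv_nth linorder_neqE_nat)
qed

lemma nth_index_pairs:
  assumes "a < n choose 2"
  obtains i j where "index_pairs n ! a = (i, j)" "i < j" "j < n"
proof -
  have "index_pairs n ! a \<in> set (index_pairs n)"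
    using assms by (simp add: length_index_pairs)
  then show ?thesis using that by (auto simp: set_index_pairs)
qed

lemma cmat_compound_2:
  assumes A: "A \<in> carrier_mat n n"
  shows "cmat (compound_2 A) = compound_2 (cmat A)"
proof (rule eq_matI)
  fix a b assume "a < dim_row (compound_2 (cmat A))" "b < dim_col (compound_2 (cmat A))"
  then have ab: "a < n choose 2" "b < n choose 2"
    using A by (auto simp: compound_2_def)
  obtain i j where ij: "index_pairs n ! a = (i, j)" "i < j" "j < n"
    using nth_index_pairs[OF ab(1)] .
  obtain k l where kl: "index_pairs n ! b = (k, l)" "k < l" "l < n"
    using nth_index_pairs[OF ab(2)] .
  have "cmat (compound_2 A) $$ (a, b) = of_real (compound_2 A $$ (a, b))"
    using A ab compound_2_carrier[OF A] by simp
  then show "cmat (compound_2 A) $$ (a, b) = compound_2 (cmat A) $$ (a, b)"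
    using A ab ij kl by (simp add: index_compound_2[of _ n] minor_2_def)
qed (use A in \<open>auto simp: compound_2_def\<close>)

lemma sum_index_pairs:
  "(\<Sum>a = 0..<n choose 2. f (index_pairs n ! a)) = (\<Sum>p | fst p < snd p \<and> snd p < n. f p)"
proof -
  have "(\<Sum>a = 0..<n choose 2. f (index_pairs n ! a)) = sum_list (map f (index_pairs n))"
    by (simp add: sum_list_sum_nth length_index_pairs)
  also have "\<dots> = sum f (set (index_pairs n))"
    by (rule sum_list_distinct_conv_sum_set[OF distinct_index_pairs])
  also have "set (index_pairs n) = {p. fst p < snd p \<and> snd p < n}"
    by (auto simp: set_index_pairs)
  finally show ?thesis .
qed

text \<open>The square splits into the diagonal, the upper triangle and its mirror image; this is
  the regrouping behind Cauchy-Binet.\<close>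

lemma sum_square_by_pairs:
  fixes f :: "nat \<Rightarrow> nat \<Rightarrow> 'a::comm_monoid_add"
  assumes diag: "\<And>k. f k k = 0"
  shows "(\<Sum>k = 0..<n. \<Sum>l = 0..<n. f k l)
    = (\<Sum>p | fst p < snd p \<and> snd p < n. f (fst p) (snd p) + f (snd p) (fst p))"
proof -
  let ?U = "{p. fst p < snd p \<and> snd p < n}" and ?f = "\<lambda>p. f (fst p) (snd p)"
  have fin: "finite ?U" by (rule finite_subset[of _ "{0..<n} \<times> {0..<n}"]) auto
  have "(\<Sum>k = 0..<n. \<Sum>l = 0..<n. f k l) = sum ?f ({0..<n} \<times> {0..<n})"
    by (simp add: sum.cartesian_product case_prod_unfold)
  also have "\<dots> = sum ?f (?U \<union> prod.swap ` ?U)"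
  proof (intro sum.mono_neutral_right ballI)
    fix p assume "p \<in> {0..<n} \<times> {0..<n} - (?U \<union> prod.swap ` ?U)"
    then have "fst p = snd p"
      by (cases p, cases "fst p" "snd p" rule: linorder_cases)
        (auto simp: image_iff)
    then show "?f p = 0" using diag by simp
  qed auto
  also have "\<dots> = sum ?f ?U + sum ?f (prod.swap ` ?U)"
    using fin by (intro sum.union_disjoint) auto
  also have "sum ?f (prod.swap ` ?U) = (\<Sum>p\<in>?U. f (snd p) (fst p))"
    by (subst sum.reindex) auto
  finally show ?thesis by (simp add: sum.distrib)
qed

text \<open>The Cauchy-Binet formula for minors of order 2. In the expanded double sum the factor
  from \<open>B\<close> is antisymmetric in \<open>k\<close> and \<open>l\<close>, so pairing
  \<open>(k, l)\<close> with \<open>(l, k)\<close> antisymmetrises the factor from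
  \<open>A\<close>.\<close>

lemma minor_2_mult:
  fixes A B :: "'a::comm_ring_1 mat"
  assumes A: "A \<in> carrier_mat n n" and B: "B \<in> carrier_mat n n"
    and ij: "i < n" "j < n" and pq: "p < n" "q < n"
  shows "minor_2 (A * B) (i, j) (p, q)
    = (\<Sum>r | fst r < snd r \<and> snd r < n. minor_2 A (i, j) r * minor_2 B r (p, q))"
proof -
  have AB: "(A * B) $$ (i, p) = (\<Sum>k = 0..<n. A $$ (i, k) * B $$ (k, p))" if "i < n" "p < n" for i p
    using that A B by (simp add: scalar_prod_def)
  have "minor_2 (A * B) (i, j) (p, q)
    = (\<Sum>k = 0..<n. \<Sum>l = 0..<n. A $$ (i, k) * A $$ (j, l) * (B $$ (k, p) * B $$ (l, q) - B $$ (k, q) * B $$ (l, p)))"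
    using ij pq
    by (simp add: minor_2_def AB sum_product right_diff_distrib sum_subtractf mult_ac)
  also have "\<dots> = (\<Sum>r | fst r < snd r \<and> snd r < n. minor_2 A (i, j) r * minor_2 B r (p, q))"
    by (subst sum_square_by_pairs) (auto simp: minor_2_def algebra_simps intro!: sum.cong)
  finally show ?thesis .
qed

lemma compound_2_mult:
  fixes A B :: "'a::comm_ring_1 mat"
  assumes A: "A \<in> carrier_mat n n" and B: "B \<in> carrier_mat n n"
  shows "compound_2 (A * B) = compound_2 A * compound_2 B"
proof (rule eq_matI)
  have AB: "A * B \<in> carrier_mat n n" using A B by simp
  note C = compound_2_carrier[OF A] compound_2_carrier[OF B] compound_2_carrier[OF AB]
  fix a b assume "a < dim_row (compound_2 A * compound_2 B)" "b < dim_col (compound_2 A * compound_2 B)"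
  then have ab: "a < n choose 2" "b < n choose 2" using C by auto
  obtain i j where ij: "index_pairs n ! a = (i, j)" "i < j" "j < n"
    using nth_index_pairs[OF ab(1)] .
  obtain p q where pq: "index_pairs n ! b = (p, q)" "p < q" "q < n"
    using nth_index_pairs[OF ab(2)] .
  have "(compound_2 A * compound_2 B) $$ (a, b)
      = (\<Sum>c = 0..<n choose 2. minor_2 A (i, j) (index_pairs n ! c) * minor_2 B (index_pairs n ! c) (p, q))"
    using ab C(1,2) by (simp add: scalar_prod_def index_compound_2[OF A] index_compound_2[OF B] ij(1) pq(1))
  also have "\<dots> = minor_2 (A * B) (i, j) (p, q)"
    using ij pq by (subst sum_index_pairs, subst minor_2_mult[OF A B]) auto
  also have "\<dots> = compound_2 (A * B) $$ (a, b)"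
    using index_compound_2[OF AB ab] ij pq by simp
  finally show "compound_2 (A * B) $$ (a, b) = (compound_2 A * compound_2 B) $$ (a, b)" ..
qed (use A B in \<open>auto simp: compound_2_def\<close>)

lemma compound_2_one: "compound_2 (1\<^sub>m n :: 'a::comm_ring_1 mat) = 1\<^sub>m (n choose 2)"
proof (rule eq_matI)
  fix a b assume "a < dim_row (1\<^sub>m (n choose 2) :: 'a mat)" "b < dim_col (1\<^sub>m (n choose 2) :: 'a mat)"
  then have ab: "a < n choose 2" "b < n choose 2" by auto
  obtain i j where ij: "index_pairs n ! a = (i, j)" "i < j" "j < n"
    using nth_index_pairs[OF ab(1)] .
  obtain p q where pq: "index_pairs n ! b = (p, q)" "p < q" "q < n"
    using nth_index_pairs[OF ab(2)] .
  have "a = b \<longleftrightarrow> index_pairs n ! a = index_pairs n ! b"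
    using ab by (simp add: nth_eq_iff_index_eq[OF distinct_index_pairs] length_index_pairs)
  then have eq: "a = b \<longleftrightarrow> i = p \<and> j = q" using ij pq by simp
  have "compound_2 (1\<^sub>m n :: 'a mat) $$ (a, b) = (if i = p \<and> j = q then 1 else 0)"
    using ab ij pq by (auto simp: index_compound_2[of _ n] minor_2_def)
  then show "compound_2 (1\<^sub>m n :: 'a mat) $$ (a, b) = 1\<^sub>m (n choose 2) $$ (a, b)"
    using ab eq by simp
qed (auto simp: compound_2_def)

text \<open>Compounds respect products and the identity, so the compounds of \<open>P\<close> and
  \<open>Q\<close> are again mutually inverse and carry the conjugation.\<close>

lemma similar_mat_compound_2:
  assumes "similar_mat A B"
  shows "similar_mat (compound_2 A) (compound_2 B)"
proof -
  obtain n P Q where "{A, B, P, Q} \<subseteq> carrier_mat n n"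
    and W: "P * Q = 1\<^sub>m n" "Q * P = 1\<^sub>m n" "A = P * B * Q"
    using similar_matD[OF assms] by blast
  then have C: "A \<in> carrier_mat n n" "B \<in> carrier_mat n n" "P \<in> carrier_mat n n" "Q \<in> carrier_mat n n"
    by auto
  have "compound_2 P * compound_2 Q = 1\<^sub>m (n choose 2)" "compound_2 Q * compound_2 P = 1\<^sub>m (n choose 2)"
    using W C by (simp_all flip: compound_2_mult compound_2_one)
  moreover have "compound_2 A = compound_2 P * compound_2 B * compound_2 Q"
    using C mult_carrier_mat[OF C(3,2)] unfolding W(3)
    by (simp add: compound_2_mult[of _ n] assoc_mult_mat[OF C(3,2,4)[THEN compound_2_carrier]])
  moreover have "{compound_2 A, compound_2 B, compound_2 P, compound_2 Q}
      \<subseteq> carrier_mat (n choose 2) (n choose 2)"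
    using C[THEN compound_2_carrier] by simp
  ultimately show ?thesis
    by (intro similar_matI)
qed

section \<open>Eigenvalues of the second compound\<close>

text \<open>Here the lexicographic numbering matters: if the column pair precedes the row pair, both
  products in the minor contain an entry of \<open>T\<close> below the diagonal.\<close>

lemma compound_2_upper_triangular:
  assumes T: "T \<in> carrier_mat n n" and ut: "upper_triangular T"
  shows "upper_triangular (compound_2 T)"
    and "diag_mat (compound_2 T) = map (\<lambda>(i, j). T $$ (i, i) * T $$ (j, j)) (index_pairs n)"
proof -
  have T0: "T $$ (i, j) = 0" if "j < i" "i < n" for i j
    using ut T that by auto
  note C = compound_2_carrier[OF T]
  show "upper_triangular (compound_2 T)"
    unfolding upper_triangular_def
  proof (intro allI impI)
    fix a b assume "a < dim_row (compound_2 T)" "b < a"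
    then have ab: "a < n choose 2" "b < n choose 2" "b < a" using C by auto
    obtain i j where ij: "index_pairs n ! a = (i, j)" "i < j" "j < n"
      using nth_index_pairs[OF ab(1)] .
    obtain p q where pq: "index_pairs n ! b = (p, q)" "p < q" "q < n"
      using nth_index_pairs[OF ab(2)] .
    have "p < i \<or> p = i \<and> q < j"
      using sorted_wrt_nth_less[OF sorted_index_pairs[of n] ab(3)] ab ij pq
      by (simp add: length_index_pairs)
    then show "compound_2 T $$ (a, b) = 0"
      using ij pq by (auto simp: index_compound_2[OF T ab(1,2)] minor_2_def T0)
  qed
  show "diag_mat (compound_2 T) = map (\<lambda>(i, j). T $$ (i, i) * T $$ (j, j)) (index_pairs n)"
  proof (rule nth_equalityI)
    fix a assume "a < length (diag_mat (compound_2 T))"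
    then have a: "a < n choose 2" using C by (simp add: diag_mat_def)
    obtain i j where ij: "index_pairs n ! a = (i, j)" "i < j" "j < n"
      using nth_index_pairs[OF a] .
    show "diag_mat (compound_2 T) ! a = map (\<lambda>(i, j). T $$ (i, i) * T $$ (j, j)) (index_pairs n) ! a"
      using a ij C by (simp add: diag_mat_def index_compound_2[OF T] minor_2_def T0 length_index_pairs)
  qed (use C in \<open>auto simp: diag_mat_def length_index_pairs\<close>)
qed

text \<open>The compound of a Schur form is triangular and similar to the compound of
  \<open>A\<close>, so its diagonal gives the roots with multiplicity, numbered as in
  \<open>index_pairs\<close>.\<close>

lemma char_poly_compound_2:
  fixes A :: "complex mat"
  assumes A: "A \<in> carrier_mat n n" and es: "char_poly A = (\<Prod>a\<leftarrow>es. [:- a, 1:])"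
  shows "char_poly (compound_2 A)
    = (\<Prod>a\<leftarrow>map (\<lambda>(i, j). es ! i * es ! j) (index_pairs n). [:- a, 1:])"
proof -
  obtain T P Q where sd: "schur_decomposition A es = (T, P, Q)"
    by (cases "schur_decomposition A es")
  from schur_decomposition[OF A es sd]
  have wit: "similar_mat_wit A T P Q" and ut: "upper_triangular T" and diag: "diag_mat T = es"
    by auto
  have T: "T \<in> carrier_mat n n" using similar_mat_witD2[OF A wit] by simp
  have es_nth: "es ! i = T $$ (i, i)" if "i < n" for i
    using that T by (simp add: diag[symmetric] diag_mat_def)
  have "similar_mat (compound_2 A) (compound_2 T)"
    using wit by (intro similar_mat_compound_2) (auto simp: similar_mat_def)
  then have "char_poly (compound_2 A) = char_poly (compound_2 T)"
    by (rule char_poly_similar)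
  also have "\<dots> = (\<Prod>a\<leftarrow>diag_mat (compound_2 T). [:- a, 1:])"
    by (rule char_poly_upper_triangular[OF compound_2_carrier[OF T] compound_2_upper_triangular(1)[OF T ut]])
  also have "diag_mat (compound_2 T) = map (\<lambda>(i, j). es ! i * es ! j) (index_pairs n)"
    unfolding compound_2_upper_triangular(2)[OF T ut]
    by (intro map_cong refl) (auto simp: set_index_pairs es_nth)
  finally show ?thesis .
qed

text \<open>The sign of entry \<open>(i, j)\<close> is a product of two signs, one for
  \<open>i\<close> and one for \<open>j\<close>, each being -1 exactly on \<open>J\<close>.
  Conjugation by the diagonal matrix of these signs, which is its own inverse, removes them.\<close>

lemma strictly_J_sign_symmetric_similar_abs:
  assumes B: "B \<in> carrier_mat N N" and J: "strictly_J_sign_symmetric B"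
  shows "similar_mat B (map_mat abs B)" "\<And>i j. i < N \<Longrightarrow> j < N \<Longrightarrow> map_mat abs B $$ (i, j) > 0"
proof -
  obtain J where J: "\<And>i j. i < N \<Longrightarrow> j < N \<Longrightarrow> B $$ (i, j) < 0 \<longleftrightarrow> (i \<in> J) \<noteq> (j \<in> J)"
    and nz: "\<And>i j. i < N \<Longrightarrow> j < N \<Longrightarrow> B $$ (i, j) \<noteq> 0"
    using J B unfolding strictly_J_sign_symmetric_def by fastforce
  define D :: "real mat" where "D = mat_diag N (\<lambda>i. if i \<in> J then - 1 else 1)"
  have D: "D \<in> carrier_mat N N" by (simp add: D_def)
  have DD: "D * D = 1\<^sub>m N"
    unfolding D_def mat_diag_diag by (auto simp: mat_diag_def)
  have "B = D * map_mat abs B * D"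
  proof (rule eq_matI)
    fix i j assume "i < dim_row (D * map_mat abs B * D)" "j < dim_col (D * map_mat abs B * D)"
    then have ij: "i < N" "j < N" using D by auto
    have "(D * map_mat abs B * D) $$ (i, j)
        = (if i \<in> J then - 1 else 1) * \<bar>B $$ (i, j)\<bar> * (if j \<in> J then - 1 else 1)"
      using ij B by (simp add: D_def mat_diag_mult_left[of _ N N] mat_diag_mult_right[of _ N N])
    then show "B $$ (i, j) = (D * map_mat abs B * D) $$ (i, j)"
      using J[OF ij] by (auto simp: abs_if split: if_splits)
  qed (use B D in auto)
  then show "similar_mat B (map_mat abs B)"
    using B D DD by (intro similar_matI[of _ _ D D N]) auto
  show "map_mat abs B $$ (i, j) > 0" if "i < N" "j < N" for i j
    using that B nz by simp
qed

subsection \<open>The two leading eigenvalues\<close>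

text \<open>Reduces algebraic simplicity to counting occurrences in an eigenvalue list.\<close>

lemma order_prod_linear_factors:
  fixes x :: "'a::idom"
  shows "order x (\<Prod>a\<leftarrow>as. [:- a, 1:]) = count_list as x"
proof (induction as)
  case (Cons a as)
  have "(\<Prod>a\<leftarrow>as. [:- a, 1:]) \<noteq> 0"
    by (auto simp: prod_list_zero_iff)
  then show ?case
    using Cons by (simp add: order_mult order_linear' del: mult_pCons_left)
qed simp

theorem theorem7:
  fixes A :: "real mat" and n :: nat and ev :: "complex list"
  assumes "n \<ge> 2"
    and "A \<in> carrier_mat n n"
    and "\<forall>i < n. \<forall>j < n. A $$ (i, j) > 0"
    and "strictly_J_sign_symmetric (second_compound A)"
    and "eigenvalue_enumeration A ev"
  shows "\<exists>l1 l2 :: real.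
           ev ! 0 = complex_of_real l1 \<and> ev ! 1 = complex_of_real l2 \<and>
           l1 = spectral_radius (cmat A) \<and>
           simple_eigenvalue A (complex_of_real l1) \<and>
           simple_eigenvalue A (complex_of_real l2) \<and>
           l1 > l2 \<and> l2 > 0 \<and>
           (\<forall>i. 2 \<le> i \<and> i < n \<longrightarrow> l2 > cmod (ev ! i))"
proof -
  note n = assms(1) and A = assms(2)
  have n0: "n > 0" using n by simp
  have cA: "cmat A \<in> carrier_mat n n" using A by simp
  have len: "length ev = n"
    using eigenvalue_enumeration_length[OF A assms(5)] .
  have ev: "char_poly (cmat A) = (\<Prod>x\<leftarrow>ev. [:- x, 1:])"
    and sorted: "sorted_wrt (\<lambda>x y. cmod x \<ge> cmod y) ev"
    using assms(5) by (auto simp: eigenvalue_enumeration_def)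
  have mono: "cmod (ev ! j) \<le> cmod (ev ! i)" if "i \<le> j" "j < n" for i j
    using sorted_wrt_nth_less[OF sorted, of i j] that len by (cases "i = j") auto
  obtain k r where k: "k < n" and r: "r > 0" "ev ! k = of_real r"
    and r_dom: "\<And>i. i < n \<Longrightarrow> i \<noteq> k \<Longrightarrow> cmod (ev ! i) < r"
    using perron_dominant[OF A n0 _ ev] assms(3) len by metis
  \<comment> \<open>\<open>ev ! 0\<close> has maximal modulus, while every position other than
    \<open>k\<close> lies strictly below \<open>r\<close>.\<close>
  have "k = 0"
    using mono[of 0 k] r_dom[of 0] k r n0 by (cases "k = 0") auto
  note r = r[unfolded this] and r_dom = r_dom[unfolded this]

  define N where "N = n choose 2"
  have N: "N > 0" using n by (simp add: N_def)
  define C where "C = compound_2 A"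
  have C: "C \<in> carrier_mat N N" using compound_2_carrier[OF A] by (simp add: C_def N_def)
  have "strictly_J_sign_symmetric C" using assms(4) by (simp add: C_def second_compound_eq)
  note abs = strictly_J_sign_symmetric_similar_abs[OF C this]
  define es where "es = map (\<lambda>(i, j). ev ! i * ev ! j) (index_pairs n)"
  \<comment> \<open>Similarity lets Perron dominance of the positive matrix of absolute values speak
    about the products in \<open>es\<close>.\<close>
  have "char_poly (cmat (map_mat abs C)) = char_poly (cmat C)"
    using char_poly_similar[OF abs(1)] C by (simp add: of_real_hom.char_poly_hom[of _ N])
  also have "\<dots> = (\<Prod>a\<leftarrow>es. [:- a, 1:])"
    unfolding C_def cmat_compound_2[OF A] es_def by (rule char_poly_compound_2[OF cA ev])
  finally have es: "char_poly (cmat (map_mat abs C)) = (\<Prod>a\<leftarrow>es. [:- a, 1:])" .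
  have len_es: "length es = N" by (simp add: es_def N_def length_index_pairs)
  obtain a s where a: "a < N" and s: "s > 0" "es ! a = of_real s"
    and s_dom: "\<And>b. b < N \<Longrightarrow> b \<noteq> a \<Longrightarrow> cmod (es ! b) < s"
    using perron_dominant[OF _ N abs(2) es] C len_es by (metis map_carrier_mat)
  obtain i j where ij: "index_pairs n ! a = (i, j)" "i < j" "j < n"
    using nth_index_pairs a N_def by blast
  have s_eq: "of_real s = ev ! i * ev ! j"
    using s(2) a ij by (simp add: es_def length_index_pairs N_def)
  have pair_dom: "cmod (ev ! p) * cmod (ev ! q) < s" if "p < q" "q < n" "(p, q) \<noteq> (i, j)" for p q
  proof -
    have "(p, q) \<in> set (index_pairs n)" using that by (simp add: set_index_pairs)
    then obtain b where b: "b < N" "index_pairs n ! b = (p, q)"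
      by (auto simp: in_set_conv_nth length_index_pairs N_def)
    then have "b \<noteq> a" using that ij by auto
    then have "cmod (es ! b) < s" using s_dom b by simp
    then show ?thesis using b by (simp add: es_def length_index_pairs N_def norm_mult)
  qed
  \<comment> \<open>No product of two distinct positions exceeds that of the first two in modulus,
    so the strictly dominant pair must be this one.\<close>
  have "(0, 1) = (i, j)"
  proof (rule ccontr)
    assume "(0, 1) \<noteq> (i, j)"
    then have "cmod (ev ! 0) * cmod (ev ! 1) < s" using pair_dom[of 0 1] n by simp
    also have "s = cmod (ev ! i) * cmod (ev ! j)"
      using s s_eq by (metis norm_mult norm_of_real abs_of_pos)
    also have "\<dots> \<le> cmod (ev ! 0) * cmod (ev ! 1)"
      using ij by (intro mult_mono mono) auto
    finally show False by simp
  qed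
  then have ij01: "i = 0" "j = 1" by auto
  \<comment> \<open>From \<open>ev ! 0 * ev ! 1 = s\<close> and \<open>ev ! 0 = r\<close>;
    positivity of \<open>s\<close> and \<open>r\<close> makes the second eigenvalue real and
    positive.\<close>
  define l2 where "l2 = s / r"
  have l2: "ev ! 1 = of_real l2" "l2 > 0"
    using s_eq r s by (auto simp: ij01 l2_def field_simps)
  have "l2 < r" using r_dom[of 1] n l2 by simp
  \<comment> \<open>The pair \<open>(0, q)\<close> is dominated by \<open>(0, 1)\<close>; the common
    factor \<open>r\<close> cancels.\<close>
  have l2_dom: "cmod (ev ! q) < l2" if "2 \<le> q" "q < n" for q
    using pair_dom[of 0 q] that r ij01 by (simp add: l2_def field_simps)

  have root: "eigenvalue (cmat A) x \<longleftrightarrow> x \<in> set ev" for x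
    unfolding eigenvalue_root_char_poly[OF cA] ev by (auto simp: poly_prod_list prod_list_zero_iff)
  have "spectral_radius (cmat A) = r"
  proof (rule antisym)
    obtain m where "m \<in> set ev" "cmod m = spectral_radius (cmat A)"
      using spectral_radius_mem_max(1)[OF cA n0] by (auto simp: spectrum_def root)
    then obtain p where "p < n" "cmod (ev ! p) = spectral_radius (cmat A)"
      using len by (auto simp: in_set_conv_nth)
    then show "spectral_radius (cmat A) \<le> r" using mono[of 0 p] r by simp
    have "of_real r \<in> set ev" using r len n0 by (metis nth_mem)
    then have "cmod (of_real r) \<le> spectral_radius (cmat A)"
      by (intro spectral_radius_mem_max(2)[OF cA n0] imageI) (simp add: spectrum_def root)
    then show "r \<le> spectral_radius (cmat A)" using r by simp
  qed
  \<comment> \<open>A value found at a single position of \<open>ev\<close> is a root of order 1;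
    the strict gaps in modulus ensure this for \<open>r\<close> and \<open>l2\<close>.\<close>
  moreover have "simple_eigenvalue A (of_real l)"
    if "p < n" "ev ! p = of_real l" "\<And>q. q < n \<Longrightarrow> q \<noteq> p \<Longrightarrow> ev ! q \<noteq> of_real l" for p l
  proof -
    have "count_list ev (of_real l) = card {q. q < length ev \<and> ev ! q = of_real l}"
      by (simp add: count_list_eq_length_filter length_filter_conv_card eq_commute)
    also have "{q. q < length ev \<and> ev ! q = of_real l} = {p}" using that len by auto
    finally show ?thesis
      using that len unfolding simple_eigenvalue_def root ev order_prod_linear_factors
      by (metis card_1_singleton_iff One_nat_def nth_mem)
  qed
  note simple = this
  have "simple_eigenvalue A (of_real r)"
    using r_dom r n0 by (intro simple[of 0]) force+
  moreover have "simple_eigenvalue A (of_real l2)"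
  proof (rule simple[of 1])
    show "ev ! q \<noteq> of_real l2" if "q < n" "q \<noteq> 1" for q
      using that r \<open>l2 < r\<close> l2_dom[of q] l2(2) by (cases "q = 0") auto
  qed (use n l2 in auto)
  ultimately show ?thesis
    using r l2 \<open>l2 < r\<close> l2_dom by (intro exI[of _ r] exI[of _ l2]) auto
qed

end
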